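(* Let $\mathbb{X}$ be one of $\mathbb{S}^3$ (unit sphere, curvature $1$), $\mathbb{H}^3$ (hyperbolic space, curvature $-1$), or $\mathbb{E}^3$ (Euclidean space). Let $\Delta$ be a tetrahedron in $\mathbb{X}$ with vertices $F_1, F_2, K, L$ and edge lengths $$|F_1F_2| = x,\quad |KL| = y,\quad |F_1K| = a,\quad |F_2K| = b,\quad |F_2L| = c,\quad |F_1L| = d.$$ Put $s = \frac{a+b+c+d}{2}$, and let $\bar\Delta$ be the tetrahedron in $\mathbb{X}$ with vertices $G_1, G_2, M, N$ and edge lengths $$|G_1G_2| = x,\quad |MN| = y,\quad |G_1M| = s-a,\quad |G_2M| = s-b,\quad |G_2N| = s-c,\quad |G_1N| = s-d.$$ Let $$A = \log\tan\frac{\angle KF_1F_2}{2},\quad B = \log\tan\frac{\angle KF_2F_1}{2},\quad C = \log\tan\frac{\angle LF_2F_1}{2},\quad D = \log\tan\frac{\angle LF_1F_2}{2}$$ be the logarithms of the tangents of half the angles which the edges of lengths $a,b,c,d$ of $\Delta$ form with the edge of length $x$, and let $$\bar A = \log\tan\frac{\angle MG_1G_2}{2},\quad \bar B = \log\tan\frac{\angle MG_2G_1}{2},\quad \bar C = \log\tan\frac{\angle NG_2G_1}{2},\quad \bar D = \log\tan\frac{\angle NG_1G_2}{2}$$ be the analogous quantities for the edges of lengths $s-a, s-b, s-c, s-d$ of $\bar\Delta$. Then $$\bar A = \frac{-A+B+C+D}{2},\quad \bar B = \frac{A-B+C+D}{2},\quad \bar C = \frac{A+B-C+D}{2},\quad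 \bar D = \frac{A+B+C-D}{2}.$$
   Context: Tetrahedra are non-degenerate geodesic tetrahedra: the four vertices do not lie in a common (totally geodesic) plane; in the spherical case, the vertices are linearly independent unit vectors in $\mathbb{R}^4$, the tetrahedron is the intersection of $\mathbb{S}^3$ with the convex cone they span, and edge lengths are in $(0,\pi)$. $\angle PQR \in (0,\pi)$ denotes the angle at the vertex $Q$ of the geodesic triangle $PQR$. A tetrahedron $\bar\Delta$ with the given edge lengths always exists and is unique up to isometry. *)

theory Defs
  imports "HOL-Analysis.Analysis"
begin

record 'p geometry =
  points :: "'p set"
  gdist :: "'p \<Rightarrow> 'p \<Rightarrow> real"
  gangle :: "'p \<Rightarrow> 'p \<Rightarrow> 'p \<Rightarrow> real"  \<comment> \<open>angle \<open>PQR\<close>, i.e. at the middle argument\<close>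
  planes :: "'p set set"  \<comment> \<open>the totally geodesic surfaces\<close>

text \<open>The angle between two tangent vectors, with respect to the scalar product \<open>B\<close>.\<close>
definition form_angle :: "('v \<Rightarrow> 'v \<Rightarrow> real) \<Rightarrow> 'v \<Rightarrow> 'v \<Rightarrow> real" where
  "form_angle B u v = arccos (B u v / (sqrt (B u u) * sqrt (B v v)))"

definition E3 :: "(real^3) geometry" where
  "E3 = \<lparr> points = UNIV,
          gdist = dist,
          gangle = (\<lambda>P Q R. form_angle inner (P - Q) (R - Q)),
          planes = {p. affine p \<and> aff_dim p = 2} \<rparr>"

text \<open>The minimal geodesic of the unit sphere from \<open>Q\<close> to \<open>P\<close> (not antipodal or equal to \<open>Q\<close>)
  is \<open>t \<mapsto> cos t *\<^sub>R Q + sin t *\<^sub>R u\<close> for \<open>0 \<le> t \<le> arccos (Q \<bullet> P)\<close>, with \<open>u\<close> the normalization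
  of the component of \<open>P\<close> orthogonal to \<open>Q\<close>. So its initial direction is \<open>P - (Q \<bullet> P) *\<^sub>R Q\<close>
  up to a positive factor.\<close>
definition sph_dir :: "real^4 \<Rightarrow> real^4 \<Rightarrow> real^4" where
  "sph_dir Q P = P - (Q \<bullet> P) *\<^sub>R Q"

definition S3 :: "(real^4) geometry" where
  "S3 = \<lparr> points = sphere 0 1,
          gdist = (\<lambda>P Q. arccos (P \<bullet> Q)),
          gangle = (\<lambda>P Q R. form_angle inner (sph_dir Q P) (sph_dir Q R)),
          planes = {sphere 0 1 \<inter> V | V. subspace V \<and> dim V = 3} \<rparr>"

text \<open>Hyperbolic space is the upper sheet of the hyperboloid in Minkowski space, the fourth
  coordinate being timelike. The Minkowski form is positive definite on its tangent spaces.\<close>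
definition lorentz :: "real^4 \<Rightarrow> real^4 \<Rightarrow> real" where
  "lorentz u v = u$1 * v$1 + u$2 * v$2 + u$3 * v$3 - u$4 * v$4"

definition hyperboloid :: "(real^4) set" where
  "hyperboloid = {p. lorentz p p = -1 \<and> p$4 > 0}"

text \<open>The geodesic from \<open>Q\<close> to \<open>P\<close> is \<open>t \<mapsto> cosh t *\<^sub>R Q + sinh t *\<^sub>R u\<close>, with \<open>u\<close> the normalization
  of the component of \<open>P\<close> that is \<open>lorentz\<close>-orthogonal to \<open>Q\<close>; since \<open>lorentz Q Q = -1\<close>, this
  component is as follows.\<close>
definition hyp_dir :: "real^4 \<Rightarrow> real^4 \<Rightarrow> real^4" where
  "hyp_dir Q P = P + lorentz Q P *\<^sub>R Q"

definition H3 :: "(real^4) geometry" where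
  "H3 = \<lparr> points = hyperboloid,
          gdist = (\<lambda>P Q. arcosh (- lorentz P Q)),
          gangle = (\<lambda>P Q R. form_angle lorentz (hyp_dir Q P) (hyp_dir Q R)),
          planes = {hyperboloid \<inter> V | V. subspace V \<and> dim V = 3 \<and> hyperboloid \<inter> V \<noteq> {}} \<rparr>"

definition tetrahedron :: "'p geometry \<Rightarrow> 'p \<Rightarrow> 'p \<Rightarrow> 'p \<Rightarrow> 'p \<Rightarrow> bool" where
  "tetrahedron X P\<^sub>1 P\<^sub>2 Q R \<longleftrightarrow>
     {P\<^sub>1, P\<^sub>2, Q, R} \<subseteq> points X \<and> \<not> (\<exists>p \<in> planes X. {P\<^sub>1, P\<^sub>2, Q, R} \<subseteq> p)"

lemma in_hyperplane_iff_dependent: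
  fixes S :: "(real^4) set"
  assumes "finite S" "card S \<le> 4"
  shows "(\<exists>V. subspace V \<and> dim V = 3 \<and> S \<subseteq> V) \<longleftrightarrow> \<not> (independent S \<and> card S = 4)"
proof -
  have hyp: "(\<exists>V. subspace V \<and> dim V = 3 \<and> S \<subseteq> V) \<longleftrightarrow> dim S \<le> 3"
  proof
    assume "dim S \<le> 3"
    then have "dim S < DIM(real^4)" by simp
    then obtain n :: "real^4" where n: "n \<noteq> 0" "span S \<subseteq> {x. n \<bullet> x = 0}"
      using lowdim_subset_hyperplane by blast
    have "dim {x. n \<bullet> x = 0} = 3"
      using dim_hyperplane[OF n(1)] by simp
    moreover have "S \<subseteq> {x. n \<bullet> x = 0}"
      using n(2) span_superset[of S] by (rule order_trans[rotated])
    ultimately show "\<exists>V. subspace V \<and> dim V = 3 \<and> S \<subseteq> V"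
      using subspace_hyperplane[of n] by blast
  next
    assume "\<exists>V. subspace V \<and> dim V = 3 \<and> S \<subseteq> V"
    then obtain V where "dim V = 3" "S \<subseteq> V" by blast
    then show "dim S \<le> 3" using dim_subset[of S V] by simp
  qed
  have le: "dim S \<le> card S"
    by (rule dim_le_card') (rule assms(1))
  have eq: "dim S = card S \<longleftrightarrow> independent S"
  proof
    show "independent S" if "dim S = card S"
      by (rule card_le_dim_spanning[of S S]) (simp_all add: span_superset that assms)
  qed (rule dim_eq_card_independent)
  have "dim S \<le> 3 \<longleftrightarrow> \<not> (dim S = card S \<and> card S = 4)"
    using le assms(2) by linarith
  then show ?thesis unfolding eq hyp .
qed

text \<open>In the sphere, non-degeneracy is linear independence of the vertices.\<close>
lemma tetrahedron_S3_iff: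
  "tetrahedron S3 P\<^sub>1 P\<^sub>2 Q R \<longleftrightarrow>
     {P\<^sub>1, P\<^sub>2, Q, R} \<subseteq> sphere 0 1 \<and> distinct [P\<^sub>1, P\<^sub>2, Q, R] \<and> independent {P\<^sub>1, P\<^sub>2, Q, R}"
proof -
  define S where "S = {P\<^sub>1, P\<^sub>2, Q, R}"
  have S: "set [P\<^sub>1, P\<^sub>2, Q, R] = S" "length [P\<^sub>1, P\<^sub>2, Q, R] = 4"
    by (simp_all add: S_def)
  have fin: "finite S" by (simp add: S_def)
  have le: "card S \<le> 4"
    using card_length[of "[P\<^sub>1, P\<^sub>2, Q, R]"] unfolding S .
  have eq: "card S = 4 \<longleftrightarrow> distinct [P\<^sub>1, P\<^sub>2, Q, R]"
    using distinct_card card_distinct S by metis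
  have "(\<exists>p \<in> planes S3. S \<subseteq> p) \<longleftrightarrow>
      S \<subseteq> sphere 0 1 \<and> (\<exists>V. subspace V \<and> dim V = 3 \<and> S \<subseteq> V)"
    by (auto simp: S3_def)
  moreover have "points S3 = sphere 0 1"
    by (simp add: S3_def)
  ultimately have "tetrahedron S3 P\<^sub>1 P\<^sub>2 Q R \<longleftrightarrow> S \<subseteq> sphere 0 1 \<and> independent S \<and> card S = 4"
    unfolding tetrahedron_def S_def[symmetric] in_hyperplane_iff_dependent[OF fin le] by argo
  then show ?thesis unfolding eq unfolding S_def by argo
qed

definition edge_lengths ::
  "'p geometry \<Rightarrow> 'p \<Rightarrow> 'p \<Rightarrow> 'p \<Rightarrow> 'p \<Rightarrow> real \<Rightarrow> real \<Rightarrow> real \<Rightarrow> real \<Rightarrow> real \<Rightarrow> real \<Rightarrow> bool" where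
  "edge_lengths X P\<^sub>1 P\<^sub>2 Q R x y a b c d \<longleftrightarrow>
     gdist X P\<^sub>1 P\<^sub>2 = x \<and> gdist X Q R = y \<and>
     gdist X P\<^sub>1 Q = a \<and> gdist X P\<^sub>2 Q = b \<and> gdist X P\<^sub>2 R = c \<and> gdist X P\<^sub>1 R = d"

definition log_tan_half :: "'p geometry \<Rightarrow> 'p \<Rightarrow> 'p \<Rightarrow> 'p \<Rightarrow> real" where
  "log_tan_half X P Q R = ln (tan (gangle X P Q R / 2))"

definition log_tan_halves ::
  "'p geometry \<Rightarrow> 'p \<Rightarrow> 'p \<Rightarrow> 'p \<Rightarrow> 'p \<Rightarrow> real \<Rightarrow> real \<Rightarrow> real \<Rightarrow> real \<Rightarrow> bool" where
  "log_tan_halves X P\<^sub>1 P\<^sub>2 Q R A B C D \<longleftrightarrow>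
     A = log_tan_half X Q P\<^sub>1 P\<^sub>2 \<and> B = log_tan_half X Q P\<^sub>2 P\<^sub>1 \<and>
     C = log_tan_half X R P\<^sub>2 P\<^sub>1 \<and> D = log_tan_half X R P\<^sub>1 P\<^sub>2"

end

theory Submission
  imports Defs
begin

text \<open>The theorem is a statement about the two faces at the edge of length \<open>x\<close>. Let
  \<open>sn\<close> be \<open>sin\<close>, \<open>sinh\<close> or the identity, according to the geometry. In a triangle with sides
  \<open>a\<close>, \<open>b\<close>, \<open>x\<close> the law of cosines gives
  \<open>tan\<^sup>2 (\<theta> / 2) = sn ((a+b-x)/2) sn ((x-a+b)/2) / (sn ((x+a+b)/2) sn ((x+a-b)/2))\<close>
  for the angle \<open>\<theta>\<close> between the sides \<open>a\<close> and \<open>x\<close>, and the same with \<open>a\<close> and \<open>b\<close> exchanged for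
  the angle between \<open>b\<close> and \<open>x\<close>. In the product of the two expressions the factors that involve
  \<open>a - b\<close> cancel, in their quotient those that involve \<open>a + b\<close>. So the logarithms \<open>A\<close> and \<open>B\<close> of the
  two tangents satisfy
  \<open>A + B = \<phi> (a + b)\<close> and \<open>A - B = \<phi> (a - b)\<close>, where
  \<open>\<phi> t = ln \<bar>sn ((x-t)/2) / sn ((x+t)/2)\<bar>\<close>
  is the same function both times (\<open>log_tan_half_sum_diff\<close>), and it is odd. Likewise
  \<open>D + C = \<phi> (d + c)\<close> and \<open>D - C = \<phi> (d - c)\<close>.

  Replacing \<open>a, b, c, d\<close> by \<open>s - a, s - b, s - c, s - d\<close> exchanges \<open>a + b\<close> with \<open>d + c\<close> and changes
  the signs of \<open>a - b\<close> and \<open>d - c\<close>. Hence it exchanges \<open>A + B\<close> with \<open>D + C\<close> and changes the signs of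
  \<open>A - B\<close> and \<open>D - C\<close>, which is the claim (\<open>tetrahedra_log_tan_halves\<close>).

  What depends on the geometry is the half-angle formula. The law of cosines is the computation of
  the scalar product of the initial directions of two sides. That the angle lies strictly between
  \<open>0\<close> and \<open>\<pi>\<close>, so that the logarithms are meaningful, is the strict Cauchy-Schwarz inequality for
  these directions (\<open>strict_Cauchy_Schwarz_form\<close>): they are linearly independent because a face
  of a non-degenerate tetrahedron is a non-degenerate triangle.\<close>

section \<open>Half angles in a triangle\<close>

text \<open>The classical half-angle formula for the angle at \<open>Q\<close>, together with the fact that this angle
  is neither \<open>0\<close> nor \<open>\<pi>\<close>. The positivity of \<open>t\<close> forces all four factors to be nonzero.\<close>
definition half_angle_formula :: "(real \<Rightarrow> real) \<Rightarrow> 'p geometry \<Rightarrow> 'p \<Rightarrow> 'p \<Rightarrow> 'p \<Rightarrow> bool" where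
  "half_angle_formula sn X P Q R \<longleftrightarrow>
     (let a = gdist X Q P; x = gdist X Q R; b = gdist X R P; t = tan (gangle X P Q R / 2)
      in t > 0 \<and> t\<^sup>2 = (sn ((a + b - x) / 2) * sn ((x - (a - b)) / 2))
                     / (sn ((x + (a + b)) / 2) * sn ((x + (a - b)) / 2)))"

text \<open>The half-angle formula determines the square of a tangent, hence a ratio only up to sign; the
  absolute value selects the positive one.\<close>
definition log_ratio :: "(real \<Rightarrow> real) \<Rightarrow> real \<Rightarrow> real \<Rightarrow> real" where
  "log_ratio sn x t = ln \<bar>sn ((x - t) / 2) / sn ((x + t) / 2)\<bar>"

lemma log_ratio_minus: "log_ratio sn x (- t) = - log_ratio sn x t"
  unfolding log_ratio_def using ln_inverse[of "\<bar>sn ((x - t) / 2) / sn ((x + t) / 2)\<bar>"]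
  by (cases "sn ((x - t) / 2) / sn ((x + t) / 2) = 0") (auto simp: abs_inverse)

lemma ln_abs_of_power2_eq:
  fixes p r :: real
  assumes "p > 0" "p\<^sup>2 = r\<^sup>2"
  shows "ln p = ln \<bar>r\<bar>"
  using assms by (metis abs_of_pos power2_eq_iff abs_minus_cancel)

text \<open>The squared tangents are \<open>u m / (v n)\<close> and \<open>u n / (v m)\<close>, with \<open>u\<close>, \<open>v\<close> depending on \<open>a + b\<close>
  and \<open>m\<close>, \<open>n\<close> depending on \<open>a - b\<close>; so the product of the tangents is \<open>\<bar>u / v\<bar>\<close> and their quotient
  \<open>\<bar>m / n\<bar>\<close>. Oddness of \<open>sn\<close> brings \<open>u\<close> into the form that makes both ratios values of one function.\<close>
lemma log_tan_half_sum_diff: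
  assumes P: "half_angle_formula sn X R P Q" and Q: "half_angle_formula sn X R Q P"
    and sym: "gdist X Q P = gdist X P Q" and odd: "\<And>t. sn (- t) = - sn t"
  defines "x \<equiv> gdist X P Q" and "a \<equiv> gdist X P R" and "b \<equiv> gdist X Q R"
  shows "log_tan_half X R P Q + log_tan_half X R Q P = log_ratio sn x (a + b)"
    and "log_tan_half X R P Q - log_tan_half X R Q P = log_ratio sn x (a - b)"
proof -
  define p where "p = tan (gangle X R P Q / 2)"
  define q where "q = tan (gangle X R Q P / 2)"
  define u where "u = sn ((a + b - x) / 2)"
  define v where "v = sn ((x + (a + b)) / 2)"
  define m where "m = sn ((x - (a - b)) / 2)"
  define n where "n = sn ((x + (a - b)) / 2)"
  have pos: "p > 0" "q > 0"
    using P Q unfolding half_angle_formula_def Let_def p_def q_def by blast+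
  have "x - (b - a) = x + (a - b)" "x + (b - a) = x - (a - b)" "b + a = a + b" by simp_all
  then have sq: "p\<^sup>2 = (u * m) / (v * n)" "q\<^sup>2 = (u * n) / (v * m)"
    using P Q unfolding half_angle_formula_def Let_def p_def q_def u_def v_def m_def n_def
      x_def a_def b_def sym by (metis)+
  have "p\<^sup>2 \<noteq> 0" using pos by simp
  then have nz: "u \<noteq> 0" "v \<noteq> 0" "m \<noteq> 0" "n \<noteq> 0"
    unfolding sq by auto
  have "(p * q)\<^sup>2 = (u / v)\<^sup>2" "(p / q)\<^sup>2 = (m / n)\<^sup>2"
    unfolding power_mult_distrib power_divide[of p] sq using nz
    by (simp_all add: field_simps power2_eq_square)
  then have "ln p + ln q = ln \<bar>u / v\<bar>" "ln p - ln q = ln \<bar>m / n\<bar>"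
    using pos ln_abs_of_power2_eq[of "p * q" "u / v"] ln_abs_of_power2_eq[of "p / q" "m / n"]
      ln_mult_pos[of p q] ln_div[of p q] by simp_all
  moreover have "\<bar>u / v\<bar> = \<bar>sn ((x - (a + b)) / 2) / v\<bar>"
  proof -
    have "(x - (a + b)) / 2 = - ((a + b - x) / 2)" by (simp add: field_simps)
    then show ?thesis unfolding u_def by (simp only: odd abs_divide abs_minus_cancel)
  qed
  ultimately show "log_tan_half X R P Q + log_tan_half X R Q P = log_ratio sn x (a + b)"
    and "log_tan_half X R P Q - log_tan_half X R Q P = log_ratio sn x (a - b)"
    unfolding log_tan_half_def log_ratio_def p_def[symmetric] q_def[symmetric]
      v_def m_def n_def by (simp_all only:)
qed

text \<open>In the coordinates \<open>a + b, a - b, d + c, d - c\<close>, the passage to the second tetrahedron exchanges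
  the two sums and negates the two differences. The odd function \<open>log_ratio sn x\<close> transports this to
  \<open>A + B, A - B, D + C, D - C\<close>.\<close>
lemma tetrahedra_log_tan_halves:
  assumes sym: "\<And>P Q. gdist X P Q = gdist X Q P" and odd: "\<And>t. sn (- t) = - sn t"
    and formula: "\<And>P\<^sub>1 P\<^sub>2 Q R. tetrahedron X P\<^sub>1 P\<^sub>2 Q R \<Longrightarrow>
      half_angle_formula sn X Q P\<^sub>1 P\<^sub>2 \<and> half_angle_formula sn X Q P\<^sub>2 P\<^sub>1 \<and>
      half_angle_formula sn X R P\<^sub>1 P\<^sub>2 \<and> half_angle_formula sn X R P\<^sub>2 P\<^sub>1"
    and s: "s = (a + b + c + d) / 2"
    and F: "tetrahedron X F\<^sub>1 F\<^sub>2 K L" "edge_lengths X F\<^sub>1 F\<^sub>2 K L x y a b c d"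
      "log_tan_halves X F\<^sub>1 F\<^sub>2 K L A B C D"
    and G: "tetrahedron X G\<^sub>1 G\<^sub>2 M N"
      "edge_lengths X G\<^sub>1 G\<^sub>2 M N x y (s - a) (s - b) (s - c) (s - d)"
      "log_tan_halves X G\<^sub>1 G\<^sub>2 M N A' B' C' D'"
  shows "A' = (- A + B + C + D) / 2 \<and> B' = (A - B + C + D) / 2 \<and>
         C' = (A + B - C + D) / 2 \<and> D' = (A + B + C - D) / 2"
proof -
  let ?\<phi> = "log_ratio sn x"
  have sums: "A + B = ?\<phi> (a + b) \<and> A - B = ?\<phi> (a - b) \<and> D + C = ?\<phi> (d + c) \<and> D - C = ?\<phi> (d - c)"
    if "tetrahedron X F\<^sub>1 F\<^sub>2 K L" "edge_lengths X F\<^sub>1 F\<^sub>2 K L x y a b c d"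
      "log_tan_halves X F\<^sub>1 F\<^sub>2 K L A B C D" for F\<^sub>1 F\<^sub>2 K L a b c d A B C D
  proof -
    note H = formula[OF that(1)]
    show ?thesis
      using log_tan_half_sum_diff[of sn X K F\<^sub>1 F\<^sub>2] log_tan_half_sum_diff[of sn X L F\<^sub>1 F\<^sub>2]
        H sym odd that(2,3)
      unfolding edge_lengths_def log_tan_halves_def by metis
  qed
  have args: "(s - a) + (s - b) = d + c" "(s - d) + (s - c) = a + b"
    "(s - a) - (s - b) = - (a - b)" "(s - d) - (s - c) = - (d - c)"
    using s by (simp_all add: field_simps)
  have "A' + B' = D + C" "A' - B' = - (A - B)" "D' + C' = A + B" "D' - C' = - (D - C)"
    using sums[OF F] sums[OF G] unfolding args log_ratio_minus by simp_all
  then show ?thesis by (simp add: field_simps)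
qed

section \<open>Angles with respect to a form that is positive on a subspace\<close>

text \<open>The subspace \<open>T\<close> is there for hyperbolic space, where the Minkowski form is indefinite but
  positive definite on each tangent space.\<close>
lemma strict_Cauchy_Schwarz_form:
  fixes B :: "'v::real_vector \<Rightarrow> 'v \<Rightarrow> real"
  assumes B: "bilinear B" "\<And>u v. B u v = B v u"
    and T: "subspace T" "\<And>w. w \<in> T \<Longrightarrow> w \<noteq> 0 \<Longrightarrow> B w w > 0"
    and uv: "u \<in> T" "v \<in> T" "v \<noteq> 0" "\<And>t. u \<noteq> t *\<^sub>R v"
  shows "B u u > 0" "B v v > 0" "(B u v)\<^sup>2 < B u u * B v v"
proof -
  show "B u u > 0" using T uv uv(4)[of 0] by simp
  show v: "B v v > 0" using T uv by simp
  \<comment> \<open>the component of \<open>u\<close> orthogonal to \<open>v\<close>\<close>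
  define w where "w = u - (B u v / B v v) *\<^sub>R v"
  have "w \<in> T" "w \<noteq> 0"
    unfolding w_def using T(1) uv by (simp_all add: subspace_diff subspace_scale)
  then have "0 < B w w" by (rule T(2))
  also have "B w w = B u u - (B u v)\<^sup>2 / B v v"
    unfolding w_def using v B(2)[of v u]
    by (simp add: bilinear_lsub[OF B(1)] bilinear_rsub[OF B(1)] bilinear_lmul[OF B(1)]
        bilinear_rmul[OF B(1)] field_simps power2_eq_square)
  finally show "(B u v)\<^sup>2 < B u u * B v v"
    using v by (simp add: field_simps)
qed

text \<open>This is \<open>tan\<^sup>2 (\<theta> / 2) = (1 - cos \<theta>) / (1 + cos \<theta>)\<close>. In each geometry \<open>p\<close> and \<open>q\<close> are \<open>sn\<close> of the
  two adjacent sides, and the law of cosines turns \<open>p q \<plusminus> B u v\<close> into a difference of two values of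
  the cosine (or its analogue), which factors into twice a product, \<open>2 X\<close> or \<open>2 Y\<close>.\<close>
lemma tan_half_form_angle:
  assumes pq: "p > 0" "q > 0" "B u u = p\<^sup>2" "B v v = q\<^sup>2"
    and CS: "(B u v)\<^sup>2 < B u u * B v v"
    and XY: "p * q - B u v = 2 * X" "p * q + B u v = 2 * Y"
  shows "tan (form_angle B u v / 2) > 0"
    and "(tan (form_angle B u v / 2))\<^sup>2 = X / Y"
proof -
  define k where "k = B u v / (p * q)"
  have angle: "form_angle B u v = arccos k"
    unfolding form_angle_def k_def pq(3,4) using pq(1,2) by simp
  have "k\<^sup>2 < 1"
    using CS pq unfolding k_def pq(3,4) by (simp add: field_simps)
  then have k: "-1 < k" "k < 1" by (simp_all add: power2_less_1_iff abs_square_less_1)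
  then have bd: "0 < arccos k" "arccos k < pi"
    by (simp_all add: arccos_lt_bounded)
  then show "tan (form_angle B u v / 2) > 0"
    unfolding angle by (intro tan_gt_zero) auto
  have c: "cos (arccos k) = k" using k by simp
  have half: "(cos (arccos k / 2))\<^sup>2 = (1 + k) / 2" "(sin (arccos k / 2))\<^sup>2 = (1 - k) / 2"
    using cos_double_cos[of "arccos k / 2"] cos_double_sin[of "arccos k / 2"] c
    by simp_all
  have "(tan (arccos k / 2))\<^sup>2 = (1 - k) / (1 + k)"
    unfolding tan_def power_divide half using k by (simp add: field_simps)
  also have "\<dots> = (p * q * (1 - k)) / (p * q * (1 + k))"
    using pq(1,2) by simp
  also have "\<dots> = (p * q - B u v) / (p * q + B u v)"
    unfolding k_def using pq(1,2) by (simp add: right_diff_distrib distrib_left)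
  also have "\<dots> = X / Y"
    unfolding XY by simp
  finally show "(tan (form_angle B u v / 2))\<^sup>2 = X / Y"
    unfolding angle .
qed

section \<open>Non-degenerate triangles in the three geometries\<close>

lemma independent_triangle:
  fixes S :: "'v::real_vector set"
  assumes "independent S" "P \<in> S" "Q \<in> S" "R \<in> S" "distinct [P, Q, R]"
  shows "P \<notin> span {Q, R}" "R \<notin> span {Q}"
proof -
  have *: "z \<notin> span U" if "z \<in> S" "U \<subseteq> S - {z}" for z U
    using assms(1) that span_mono[OF that(2)] unfolding dependent_def by blast
  show "P \<notin> span {Q, R}" "R \<notin> span {Q}"
    by (rule *; use assms in auto)+
qed

text \<open>The initial directions at \<open>Q\<close> of the sides \<open>QP\<close> and \<open>QR\<close> differ from \<open>P\<close> and \<open>R\<close> by multiples of \<open>Q\<close>,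
  in the sphere and in the hyperboloid. So they inherit linear independence from the vertices.\<close>
lemma tangent_independent:
  assumes "P \<notin> span {Q, R}" "R \<notin> span {Q}"
  shows "R + m *\<^sub>R Q \<noteq> 0" "P + l *\<^sub>R Q \<noteq> t *\<^sub>R (R + m *\<^sub>R Q)"
proof -
  show "R + m *\<^sub>R Q \<noteq> 0"
  proof
    assume "R + m *\<^sub>R Q = 0"
    then have "R = (- m) *\<^sub>R Q" by (simp add: eq_neg_iff_add_eq_0)
    then show False using assms(2) by (metis span_base span_scale insertI1)
  qed
  show "P + l *\<^sub>R Q \<noteq> t *\<^sub>R (R + m *\<^sub>R Q)"
  proof
    assume "P + l *\<^sub>R Q = t *\<^sub>R (R + m *\<^sub>R Q)"
    then have "P = t *\<^sub>R R + (t * m - l) *\<^sub>R Q" by (simp add: algebra_simps eq_diff_eq)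
    moreover have "t *\<^sub>R R + (t * m - l) *\<^sub>R Q \<in> span {Q, R}"
      by (intro span_add span_scale span_base) auto
    ultimately show False using assms(1) by simp
  qed
qed

lemma half_angle_formula_S3:
  assumes unit: "norm P = 1" "norm Q = 1" "norm R = 1"
    and nondeg: "P \<notin> span {Q, R}" "R \<notin> span {Q}"
  shows "half_angle_formula sin S3 P Q R"
proof -
  define u where "u = sph_dir Q P"
  define v where "v = sph_dir Q R"
  define a where "a = arccos (Q \<bullet> P)"
  define b where "b = arccos (R \<bullet> P)"
  define x where "x = arccos (Q \<bullet> R)"
  have self: "P \<bullet> P = 1" "Q \<bullet> Q = 1" "R \<bullet> R = 1"
    using unit by (simp_all add: dot_square_norm)
  have dir: "v \<noteq> 0" "u \<noteq> t *\<^sub>R v" for t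
    using tangent_independent(1)[OF nondeg, of "- (Q \<bullet> R)"]
      tangent_independent(2)[OF nondeg, of "- (Q \<bullet> P)" t "- (Q \<bullet> R)"]
    by (simp_all add: u_def v_def sph_dir_def)
  have CS: "u \<bullet> u > 0" "v \<bullet> v > 0" "(u \<bullet> v)\<^sup>2 < (u \<bullet> u) * (v \<bullet> v)"
    using strict_Cauchy_Schwarz_form[of inner UNIV u v] dir bounded_bilinear_inner
    by (simp_all add: bilinear_conv_bounded_bilinear inner_commute)
  have le: "\<bar>Q \<bullet> P\<bar> \<le> 1" "\<bar>Q \<bullet> R\<bar> \<le> 1" "\<bar>R \<bullet> P\<bar> \<le> 1"
    using Cauchy_Schwarz_ineq2[of Q P] Cauchy_Schwarz_ineq2[of Q R] Cauchy_Schwarz_ineq2[of R P]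
    by (simp_all add: unit)
  have cos: "cos a = Q \<bullet> P" "cos x = Q \<bullet> R" "cos b = R \<bullet> P"
    using le by (simp_all add: a_def b_def x_def cos_arccos_abs)
  have forms: "u \<bullet> u = (sin a)\<^sup>2" "v \<bullet> v = (sin x)\<^sup>2" "u \<bullet> v = cos b - cos a * cos x"
    unfolding sin_squared_eq cos
    by (simp_all add: u_def v_def sph_dir_def inner_diff_left inner_diff_right self
        inner_commute power2_eq_square algebra_simps)
  have "sin a \<ge> 0" "sin x \<ge> 0"
    using le by (simp_all add: a_def x_def abs_le_iff sin_ge_zero arccos_lbound arccos_ubound)
  \<comment> \<open>as \<open>u\<close> and \<open>v\<close> are nonzero, neither \<open>P\<close> nor \<open>R\<close> is \<open>Q\<close> or its antipode\<close>
  then have pos: "sin a > 0" "sin x > 0"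
    using CS(1,2) unfolding forms by (auto simp: less_le)
  \<comment> \<open>these are \<open>1 - cos \<theta>\<close> and \<open>1 + cos \<theta>\<close> for the angle \<open>\<theta>\<close> at \<open>Q\<close>, times \<open>sin a * sin x\<close>\<close>
  have "sin a * sin x - u \<bullet> v = cos (a - x) - cos b"
    "sin a * sin x + u \<bullet> v = cos b - cos (a + x)"
    unfolding forms by (simp_all add: cos_add cos_diff)
  then have prods: "sin a * sin x - u \<bullet> v = 2 * (sin ((a + b - x) / 2) * sin ((x - (a - b)) / 2))"
    "sin a * sin x + u \<bullet> v = 2 * (sin ((x + (a + b)) / 2) * sin ((x + (a - b)) / 2))"
    by (simp_all add: cos_diff_cos algebra_simps)
  show ?thesis
    using tan_half_form_angle[of "sin a" "sin x" inner u v, OF pos _ _ CS(3) prods] forms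
    unfolding half_angle_formula_def Let_def S3_def a_def b_def x_def u_def v_def by simp
qed

lemma bilinear_lorentz: "bilinear lorentz"
  unfolding bilinear_def lorentz_def by (auto intro!: linearI simp: algebra_simps)

lemma lorentz_commute: "lorentz u v = lorentz v u"
  by (simp add: lorentz_def mult.commute)

text \<open>Multiplied by \<open>(Q$4)\<^sup>2\<close>, the form becomes the squared length of the spatial part of \<open>w\<close> plus, by
  Lagrange's identity, the squared length of a cross product. The spatial part of \<open>w\<close> cannot vanish,
  since a tangent vector is not purely timelike.\<close>
lemma lorentz_pos_on_tangent:
  assumes Q: "lorentz Q Q = -1" and w: "lorentz Q w = 0" "w \<noteq> 0"
  shows "lorentz w w > 0"
proof -
  let ?n = "(w$1)\<^sup>2 + (w$2)\<^sup>2 + (w$3)\<^sup>2"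
  have Q4: "(Q$4)\<^sup>2 = 1 + ((Q$1)\<^sup>2 + (Q$2)\<^sup>2 + (Q$3)\<^sup>2)"
    using Q by (simp add: lorentz_def power2_eq_square)
  have w4: "Q$4 * w$4 = Q$1 * w$1 + Q$2 * w$2 + Q$3 * w$3"
    using w by (simp add: lorentz_def)
  have "(Q$4)\<^sup>2 * lorentz w w = (Q$4)\<^sup>2 * ?n - (Q$4 * w$4)\<^sup>2"
    by (simp add: lorentz_def power2_eq_square algebra_simps)
  also have "\<dots> = ?n + ((Q$1 * w$2 - Q$2 * w$1)\<^sup>2 + (Q$1 * w$3 - Q$3 * w$1)\<^sup>2
      + (Q$2 * w$3 - Q$3 * w$2)\<^sup>2)"
    unfolding w4 Q4 by (simp add: power2_eq_square algebra_simps)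
  finally have eq: "(Q$4)\<^sup>2 * lorentz w w = \<dots>" .
  have "?n \<noteq> 0"
  proof
    assume "?n = 0"
    then have z: "w$1 = 0" "w$2 = 0" "w$3 = 0"
      by (smt (verit) zero_le_power2 power2_eq_iff_nonneg zero_eq_power2)+
    moreover have "Q$4 \<noteq> 0" using Q4 by (smt (verit) zero_le_power2 zero_eq_power2)
    ultimately have "w$4 = 0" using w4 by simp
    with z w(2) show False by (simp add: vec_eq_iff forall_4)
  qed
  then have "?n > 0" by (smt (verit) zero_le_power2)
  then have "(Q$4)\<^sup>2 * lorentz w w > 0"
    unfolding eq by (smt (verit) zero_le_power2)
  then show ?thesis by (simp add: zero_less_mult_iff)
qed

text \<open>The reversed Cauchy-Schwarz inequality on the upper sheet. It puts the argument of \<open>arcosh\<close> in the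
  definition of the distance into the range where \<open>cosh\<close> inverts \<open>arcosh\<close>.\<close>
lemma lorentz_hyperboloid_le:
  assumes "P \<in> hyperboloid" "Q \<in> hyperboloid"
  shows "lorentz P Q \<le> -1"
proof -
  have P: "(P$4)\<^sup>2 = 1 + ((P$1)\<^sup>2 + (P$2)\<^sup>2 + (P$3)\<^sup>2)" "P$4 > 0"
    and Q: "(Q$4)\<^sup>2 = 1 + ((Q$1)\<^sup>2 + (Q$2)\<^sup>2 + (Q$3)\<^sup>2)" "Q$4 > 0"
    using assms by (simp_all add: hyperboloid_def lorentz_def power2_eq_square)
  let ?m = "1 + (P$1 * Q$1 + P$2 * Q$2 + P$3 * Q$3)"
  \<comment> \<open>Lagrange's identity for the vectors \<open>(1, P$1, P$2, P$3)\<close> and \<open>(1, Q$1, Q$2, Q$3)\<close>\<close>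
  have "(P$4 * Q$4)\<^sup>2 - ?m\<^sup>2 = (P$1 - Q$1)\<^sup>2 + (P$2 - Q$2)\<^sup>2 + (P$3 - Q$3)\<^sup>2
      + (P$1 * Q$2 - P$2 * Q$1)\<^sup>2 + (P$1 * Q$3 - P$3 * Q$1)\<^sup>2 + (P$2 * Q$3 - P$3 * Q$2)\<^sup>2"
    unfolding power_mult_distrib[of "P$4"] P Q by (simp add: power2_eq_square algebra_simps)
  also have "\<dots> \<ge> 0" by simp
  finally have "?m\<^sup>2 \<le> (P$4 * Q$4)\<^sup>2" by simp
  then have "?m \<le> P$4 * Q$4"
    by (rule power2_le_imp_le) (use P(2) Q(2) in simp)
  then show ?thesis by (simp add: lorentz_def)
qed

lemma cosh_minus_cosh: "cosh a - cosh b = 2 * (sinh ((a + b) / 2) * sinh ((a - b) / 2))" for a b :: real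
proof -
  have "cosh ((a + b) / 2 + (a - b) / 2) - cosh ((a + b) / 2 - (a - b) / 2)
      = 2 * (sinh ((a + b) / 2) * sinh ((a - b) / 2))"
    unfolding cosh_add cosh_diff by simp
  then show ?thesis by (simp add: field_simps)
qed

lemma half_angle_formula_H3:
  assumes pts: "P \<in> hyperboloid" "Q \<in> hyperboloid" "R \<in> hyperboloid"
    and nondeg: "P \<notin> span {Q, R}" "R \<notin> span {Q}"
  shows "half_angle_formula sinh H3 P Q R"
proof -
  define u where "u = hyp_dir Q P"
  define v where "v = hyp_dir Q R"
  define a where "a = arcosh (- lorentz Q P)"
  define b where "b = arcosh (- lorentz R P)"
  define x where "x = arcosh (- lorentz Q R)"
  note lin = bilinear_ladd[OF bilinear_lorentz] bilinear_radd[OF bilinear_lorentz]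
    bilinear_lmul[OF bilinear_lorentz] bilinear_rmul[OF bilinear_lorentz]
  have self: "lorentz P P = -1" "lorentz Q Q = -1" "lorentz R R = -1"
    using pts by (simp_all add: hyperboloid_def)
  have dir: "v \<noteq> 0" "u \<noteq> t *\<^sub>R v" for t
    using tangent_independent[OF nondeg] by (simp_all add: u_def v_def hyp_dir_def)
  define T where "T = {w. lorentz Q w = 0}"
  have T: "subspace T" "u \<in> T" "v \<in> T"
    unfolding T_def u_def v_def hyp_dir_def
    by (simp_all add: subspace_def lin self bilinear_rzero[OF bilinear_lorentz])
  have CS: "lorentz u u > 0" "lorentz v v > 0" "(lorentz u v)\<^sup>2 < lorentz u u * lorentz v v"
    using strict_Cauchy_Schwarz_form[of lorentz T u v, OF bilinear_lorentz lorentz_commute T(1) _ T(2,3) dir]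
      lorentz_pos_on_tangent[OF self(2)] unfolding T_def by blast+
  have cosh: "cosh a = - lorentz Q P" "cosh x = - lorentz Q R" "cosh b = - lorentz R P"
    using lorentz_hyperboloid_le pts by (simp_all add: a_def b_def x_def cosh_arcosh_real)
  have forms: "lorentz u u = (sinh a)\<^sup>2" "lorentz v v = (sinh x)\<^sup>2"
    "lorentz u v = cosh a * cosh x - cosh b"
    unfolding sinh_square_eq cosh
    by (simp_all add: u_def v_def hyp_dir_def lin self lorentz_commute[of P Q] lorentz_commute[of P R] lorentz_commute[of R Q]
        power2_eq_square algebra_simps)
  have "a \<ge> 0" "x \<ge> 0"
    using lorentz_hyperboloid_le pts by (simp_all add: a_def x_def)
  then have pos: "sinh a > 0" "sinh x > 0"
    using CS(1,2) unfolding forms by (auto simp: less_le)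
  \<comment> \<open>these are \<open>1 - cos \<theta>\<close> and \<open>1 + cos \<theta>\<close> for the angle \<open>\<theta>\<close> at \<open>Q\<close>, times \<open>sinh a * sinh x\<close>\<close>
  have "sinh a * sinh x - lorentz u v = cosh b - cosh (a - x)"
    "sinh a * sinh x + lorentz u v = cosh (a + x) - cosh b"
    unfolding forms by (simp_all add: cosh_add cosh_diff)
  then have prods: "sinh a * sinh x - lorentz u v = 2 * (sinh ((a + b - x) / 2) * sinh ((x - (a - b)) / 2))"
    "sinh a * sinh x + lorentz u v = 2 * (sinh ((x + (a + b)) / 2) * sinh ((x + (a - b)) / 2))"
    by (simp_all add: cosh_minus_cosh algebra_simps)
  show ?thesis
    using tan_half_form_angle[of "sinh a" "sinh x" lorentz u v, OF pos _ _ CS(3) prods] forms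
    unfolding half_angle_formula_def Let_def H3_def a_def b_def x_def u_def v_def by simp
qed

lemma half_angle_formula_E3:
  assumes nondeg: "R \<noteq> Q" "\<And>t. P - Q \<noteq> t *\<^sub>R (R - Q)"
  shows "half_angle_formula (\<lambda>t. t) E3 P Q R"
proof -
  define u where "u = P - Q"
  define v where "v = R - Q"
  define a where "a = dist Q P"
  define b where "b = dist R P"
  define x where "x = dist Q R"
  have CS: "u \<bullet> u > 0" "v \<bullet> v > 0" "(u \<bullet> v)\<^sup>2 < (u \<bullet> u) * (v \<bullet> v)"
    using strict_Cauchy_Schwarz_form[of inner UNIV u v] nondeg bounded_bilinear_inner
    by (simp_all add: bilinear_conv_bounded_bilinear inner_commute u_def v_def)
  have forms: "u \<bullet> u = a\<^sup>2" "v \<bullet> v = x\<^sup>2" "(u - v) \<bullet> (u - v) = b\<^sup>2"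
    by (simp_all add: u_def v_def a_def b_def x_def dist_norm norm_minus_commute dot_square_norm)
  have pos: "a > 0" "x > 0"
    using nondeg(1) nondeg(2)[of 0] by (auto simp: a_def x_def)
  have "2 * (u \<bullet> v) = a\<^sup>2 + x\<^sup>2 - b\<^sup>2"
    unfolding forms[symmetric] by (simp add: inner_diff_left inner_diff_right inner_commute)
  then have prods: "a * x - u \<bullet> v = 2 * (((a + b - x) / 2) * ((x - (a - b)) / 2))"
    "a * x + u \<bullet> v = 2 * (((x + (a + b)) / 2) * ((x + (a - b)) / 2))"
    by (simp_all add: field_simps power2_eq_square)
  show ?thesis
    using tan_half_form_angle[of a x inner u v, OF pos _ _ CS(3) prods] forms
    unfolding half_angle_formula_def Let_def E3_def a_def b_def x_def u_def v_def by simp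
qed

section \<open>Faces of tetrahedra are non-degenerate\<close>

lemma tetrahedron_H3_independent:
  assumes "tetrahedron H3 P\<^sub>1 P\<^sub>2 Q R"
  shows "{P\<^sub>1, P\<^sub>2, Q, R} \<subseteq> hyperboloid" "distinct [P\<^sub>1, P\<^sub>2, Q, R]" "independent {P\<^sub>1, P\<^sub>2, Q, R}"
proof -
  define S where "S = {P\<^sub>1, P\<^sub>2, Q, R}"
  have S: "set [P\<^sub>1, P\<^sub>2, Q, R] = S" by (simp add: S_def)
  have le: "finite S" "card S \<le> 4"
    using card_length[of "[P\<^sub>1, P\<^sub>2, Q, R]"] unfolding S by (simp_all add: S_def)
  show H: "{P\<^sub>1, P\<^sub>2, Q, R} \<subseteq> hyperboloid"
    using assms by (simp add: tetrahedron_def H3_def)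
  have "\<not> (\<exists>V. subspace V \<and> dim V = 3 \<and> S \<subseteq> V)"
  proof
    assume "\<exists>V. subspace V \<and> dim V = 3 \<and> S \<subseteq> V"
    then obtain V where V: "subspace V" "dim V = 3" "S \<subseteq> V" by blast
    then have "S \<subseteq> hyperboloid \<inter> V" "hyperboloid \<inter> V \<noteq> {}"
      using H V(3) by (auto simp: S_def)
    moreover from this V have "hyperboloid \<inter> V \<in> planes H3" by (auto simp: H3_def)
    ultimately have "\<exists>p \<in> planes H3. S \<subseteq> p" by blast
    then show False using assms unfolding tetrahedron_def S_def by blast
  qed
  then have "independent S" "card S = 4"
    using in_hyperplane_iff_dependent[OF le] by blast+
  then show "independent {P\<^sub>1, P\<^sub>2, Q, R}" "distinct [P\<^sub>1, P\<^sub>2, Q, R]"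
    using card_distinct[of "[P\<^sub>1, P\<^sub>2, Q, R]"] unfolding S by (simp_all add: S_def)
qed

lemma tetrahedron_swap:
  assumes "tetrahedron X P\<^sub>1 P\<^sub>2 Q R"
  shows "tetrahedron X P\<^sub>2 P\<^sub>1 Q R" "tetrahedron X P\<^sub>1 P\<^sub>2 R Q"
proof -
  have "{P\<^sub>2, P\<^sub>1, Q, R} = {P\<^sub>1, P\<^sub>2, Q, R}" "{P\<^sub>1, P\<^sub>2, R, Q} = {P\<^sub>1, P\<^sub>2, Q, R}" by auto
  then show "tetrahedron X P\<^sub>2 P\<^sub>1 Q R" "tetrahedron X P\<^sub>1 P\<^sub>2 R Q"
    using assms unfolding tetrahedron_def by simp_all
qed

lemma tetrahedron_half_angle_S3:
  assumes "tetrahedron S3 P\<^sub>1 P\<^sub>2 Q R"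
  shows "half_angle_formula sin S3 Q P\<^sub>1 P\<^sub>2"
  using assms independent_triangle[of "{P\<^sub>1, P\<^sub>2, Q, R}" Q P\<^sub>1 P\<^sub>2]
  unfolding tetrahedron_S3_iff by (intro half_angle_formula_S3) auto

lemma tetrahedron_half_angle_H3:
  assumes "tetrahedron H3 P\<^sub>1 P\<^sub>2 Q R"
  shows "half_angle_formula sinh H3 Q P\<^sub>1 P\<^sub>2"
  using tetrahedron_H3_independent[OF assms] independent_triangle[of "{P\<^sub>1, P\<^sub>2, Q, R}" Q P\<^sub>1 P\<^sub>2]
  by (intro half_angle_formula_H3) auto

text \<open>The edge vectors from \<open>P\<close> span at most a plane, so some nonzero \<open>n\<close> is orthogonal to all of them,
  and \<open>{z. n \<bullet> z = n \<bullet> P}\<close> contains the four points. Going through \<open>n\<close> yields a plane of dimension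
  exactly \<open>2\<close> even if the points are collinear. The statement has two parts because a dependence
  of two edges need not express a given one of them through the other.\<close>
lemma E3_coplanar:
  assumes "v \<in> span {w}"
  shows "\<not> tetrahedron E3 P (P + v) (P + w) R" "\<not> tetrahedron E3 P (P + w) (P + v) R"
proof -
  let ?S = "{v, w, R - P}"
  have "?S \<subseteq> span {w, R - P}"
    using assms span_mono[of "{w}" "{w, R - P}"] by (auto intro: span_base)
  then have "dim ?S \<le> card {w, R - P}"
    by (intro span_card_ge_dim) auto
  also have "\<dots> \<le> 2" using card_length[of "[w, R - P]"] by simp
  finally have "dim ?S < DIM(real^3)" by simp
  then obtain n :: "real^3" where n: "n \<noteq> 0" "span ?S \<subseteq> {z. n \<bullet> z = 0}"
    using lowdim_subset_hyperplane by blast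
  have "n \<bullet> z = 0" if "z \<in> ?S" for z
    using n(2) span_base[OF that] by blast
  then have "n \<bullet> v = 0" "n \<bullet> w = 0" "n \<bullet> R = n \<bullet> P"
    using inner_diff_right[of n R P] by auto
  then have "{P, P + v, P + w, R} \<subseteq> {z. n \<bullet> z = n \<bullet> P}"
    by (auto simp: inner_add_right)
  moreover have "{z. n \<bullet> z = n \<bullet> P} \<in> planes E3"
    using n(1) by (simp add: E3_def affine_hyperplane aff_dim_hyperplane)
  ultimately show "\<not> tetrahedron E3 P (P + v) (P + w) R"
    unfolding tetrahedron_def by blast
  then show "\<not> tetrahedron E3 P (P + w) (P + v) R"
    unfolding tetrahedron_def by (simp add: insert_commute)
qed

lemma tetrahedron_half_angle_E3:
  assumes "tetrahedron E3 P\<^sub>1 P\<^sub>2 Q R"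
  shows "half_angle_formula (\<lambda>t. t) E3 Q P\<^sub>1 P\<^sub>2"
proof (rule half_angle_formula_E3)
  show "P\<^sub>2 \<noteq> P\<^sub>1"
    using E3_coplanar(1)[of 0 "Q - P\<^sub>1" P\<^sub>1 R] assms by (auto simp: span_zero)
  show "Q - P\<^sub>1 \<noteq> t *\<^sub>R (P\<^sub>2 - P\<^sub>1)" for t
    using E3_coplanar(2)[of "Q - P\<^sub>1" "P\<^sub>2 - P\<^sub>1" P\<^sub>1 R] assms
    by (auto simp: span_base span_scale)
qed

theorem lemma3p1:
  fixes x y a b c d s A B C D A' B' C' D' :: real
  assumes "s = (a + b + c + d) / 2"
    and "(\<exists>F\<^sub>1 F\<^sub>2 K L G\<^sub>1 G\<^sub>2 M N.
          tetrahedron S3 F\<^sub>1 F\<^sub>2 K L \<and> edge_lengths S3 F\<^sub>1 F\<^sub>2 K L x y a b c d \<and>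
          log_tan_halves S3 F\<^sub>1 F\<^sub>2 K L A B C D \<and>
          tetrahedron S3 G\<^sub>1 G\<^sub>2 M N \<and>
          edge_lengths S3 G\<^sub>1 G\<^sub>2 M N x y (s - a) (s - b) (s - c) (s - d) \<and>
          log_tan_halves S3 G\<^sub>1 G\<^sub>2 M N A' B' C' D') \<or>
         (\<exists>F\<^sub>1 F\<^sub>2 K L G\<^sub>1 G\<^sub>2 M N.
          tetrahedron H3 F\<^sub>1 F\<^sub>2 K L \<and> edge_lengths H3 F\<^sub>1 F\<^sub>2 K L x y a b c d \<and>
          log_tan_halves H3 F\<^sub>1 F\<^sub>2 K L A B C D \<and>
          tetrahedron H3 G\<^sub>1 G\<^sub>2 M N \<and>
          edge_lengths H3 G\<^sub>1 G\<^sub>2 M N x y (s - a) (s - b) (s - c) (s - d) \<and>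
          log_tan_halves H3 G\<^sub>1 G\<^sub>2 M N A' B' C' D') \<or>
         (\<exists>F\<^sub>1 F\<^sub>2 K L G\<^sub>1 G\<^sub>2 M N.
          tetrahedron E3 F\<^sub>1 F\<^sub>2 K L \<and> edge_lengths E3 F\<^sub>1 F\<^sub>2 K L x y a b c d \<and>
          log_tan_halves E3 F\<^sub>1 F\<^sub>2 K L A B C D \<and>
          tetrahedron E3 G\<^sub>1 G\<^sub>2 M N \<and>
          edge_lengths E3 G\<^sub>1 G\<^sub>2 M N x y (s - a) (s - b) (s - c) (s - d) \<and>
          log_tan_halves E3 G\<^sub>1 G\<^sub>2 M N A' B' C' D')"
  shows "A' = (- A + B + C + D) / 2 \<and> B' = (A - B + C + D) / 2 \<and>
         C' = (A + B - C + D) / 2 \<and> D' = (A + B + C - D) / 2"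
proof -
  have faces: "half_angle_formula sn X Q P\<^sub>1 P\<^sub>2 \<and> half_angle_formula sn X Q P\<^sub>2 P\<^sub>1 \<and>
      half_angle_formula sn X R P\<^sub>1 P\<^sub>2 \<and> half_angle_formula sn X R P\<^sub>2 P\<^sub>1"
    if "\<And>P\<^sub>1 P\<^sub>2 Q R. tetrahedron X P\<^sub>1 P\<^sub>2 Q R \<Longrightarrow> half_angle_formula sn X Q P\<^sub>1 P\<^sub>2"
      and "tetrahedron X P\<^sub>1 P\<^sub>2 Q R" for sn and X :: "'p geometry" and P\<^sub>1 P\<^sub>2 Q R
    using that by (meson tetrahedron_swap)
  have sym: "gdist S3 P Q = gdist S3 Q P" "gdist H3 P' Q' = gdist H3 Q' P'"
      "gdist E3 P'' Q'' = gdist E3 Q'' P''" for P Q P' Q' P'' Q''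
    by (simp_all add: S3_def H3_def E3_def inner_commute lorentz_commute dist_commute)
  note S = tetrahedra_log_tan_halves[OF sym(1) sin_minus faces[OF tetrahedron_half_angle_S3] assms(1)]
  note H = tetrahedra_log_tan_halves[OF sym(2) sinh_minus faces[OF tetrahedron_half_angle_H3] assms(1)]
  note E = tetrahedra_log_tan_halves[OF sym(3) refl faces[OF tetrahedron_half_angle_E3] assms(1)]
  from assms(2) show ?thesis
    by (elim disjE exE conjE) (rule S H E; assumption)+
qed

end
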